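(* Let $T$ be a nonempty totally ordered set, let $G$ be a totally ordered abelian group of rank one, and let $\Gamma\subseteq G^T$ be the totally ordered group of all functions $T\to G$ with well ordered support (lexicographically ordered, as described in the context). Then $\mathrm{IS}(\mathrm{isolated}(\Gamma))=\{H_t\mid t\in T\}$; i.e., the set of all isolated subgroups of $\Gamma$ having an immediate predecessor (in the set of isolated subgroups ordered by inclusion) is equal to the set of all subgroups $H_t$, $t\in T$.
   Context: A totally ordered abelian group has rank one if it is nonzero and its only isolated subgroups are $\{0\}$ and itself (equivalently, it is nonzero and archimedean). $G^T$ is the group of all functions $T\to G$ with componentwise addition; $\mathrm{supp}(f)=\{t\in T\mid f(t)\neq0\}$; $\Gamma$ is the subgroup of all $f\in G^T$ with well ordered support. $\Gamma$ is totally ordered by: $f\le g$ iff $f=g$ or, for the smallest $t\in\mathrm{supp}(f)\cup\mathrm{supp}(g)$ such that $f(t)\neq g(t)$, one has $f(t)<g(t)$. An isolated subgroup of $\Gamma$ is a subgroup $H$ such that for every $0\le h\in H$ and every $g\in\Gamma$ with $0\le g\le h$ one has $g\in H$. $\mathrm{isolated}(\Gamma)$ is the set of all isolated subgroups of $\Gamma$ (including $\{0\}$ and $\Gamma$), ordered by inclusion. For $t\in T$, the $T$-isolated subgroup $H_t$ is $H_t=\{f\in\Gamma\mid f(s)=0\text{ for all }s\in T\text{ with }s<t\}$. For a poset $S$, $a$ is an immediate predecessor of $b$ if $a<b$ and there is no $c\in S$ with $a<c<b$; $\mathrm{IS}(S)$ is the set of elements of $S$ having an immediate predecessor in $S$.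 *)

theory Defs
  imports Main
begin

section \<open>Posets: elements having an immediate predecessor\<close>

definition immediate_predecessor :: "'a::order set \<Rightarrow> 'a \<Rightarrow> 'a \<Rightarrow> bool" where
  "immediate_predecessor S a b \<longleftrightarrow> a \<in> S \<and> b \<in> S \<and> a < b \<and> \<not> (\<exists>c\<in>S. a < c \<and> c < b)"

definition IS :: "'a::order set \<Rightarrow> 'a set" where
  "IS S = {b \<in> S. \<exists>a. immediate_predecessor S a b}"


section \<open>Isolated subgroups of totally ordered abelian groups\<close>

definition add_subgroup :: "'a::ab_group_add set \<Rightarrow> bool" where
  "add_subgroup H \<longleftrightarrow> 0 \<in> H \<and> (\<forall>x\<in>H. \<forall>y\<in>H. x + y \<in> H) \<and> (\<forall>x\<in>H. - x \<in> H)"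

definition isolated_subgroup :: "'a::linordered_ab_group_add set \<Rightarrow> bool" where
  "isolated_subgroup H \<longleftrightarrow>
     add_subgroup H \<and> (\<forall>h\<in>H. 0 \<le> h \<longrightarrow> (\<forall>g. 0 \<le> g \<and> g \<le> h \<longrightarrow> g \<in> H))"

definition isolated :: "'a::linordered_ab_group_add set set" where
  "isolated = {H. isolated_subgroup H}"

definition rank_one :: "'a::linordered_ab_group_add itself \<Rightarrow> bool" where
  "rank_one _ \<longleftrightarrow>
     (UNIV :: 'a set) \<noteq> {0} \<and> (isolated :: 'a set set) = {{0}, UNIV}"


section \<open>The group of functions with well ordered support\<close>

definition supp :: "('t \<Rightarrow> 'g::zero) \<Rightarrow> 't set" where
  "supp f = {t. f t \<noteq> 0}"

definition well_ordered :: "'t::linorder set \<Rightarrow> bool" where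
  "well_ordered A \<longleftrightarrow> well_order_on A (relation_of (\<le>) A)"

lemma well_ordered_iff:
  "well_ordered A \<longleftrightarrow> (\<forall>B\<subseteq>A. B \<noteq> {} \<longrightarrow> (\<exists>m\<in>B. \<forall>x\<in>B. m \<le> x))"
proof -
  have lin: "linear_order_on A (relation_of (\<le>) A)"
    by (auto simp: linear_order_on_def partial_order_on_def preorder_on_def relation_of_def
        refl_on_def trans_def antisym_def total_on_def)
  have "wf (relation_of (\<le>) A - Id) \<longleftrightarrow> (\<forall>B\<subseteq>A. B \<noteq> {} \<longrightarrow> (\<exists>m\<in>B. \<forall>x\<in>B. m \<le> x))"
    (is "?L \<longleftrightarrow> ?R")
  proof
    assume wf: ?L
    show ?R
    proof (intro allI impI)
      fix B assume B: "B \<subseteq> A" "B \<noteq> {}"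
      then obtain z where z: "z \<in> B" "\<And>y. (y, z) \<in> relation_of (\<le>) A - Id \<Longrightarrow> y \<notin> B"
        using wfE_min'[OF wf] by metis
      have "z \<le> x" if "x \<in> B" for x
        using z(2)[of x] z(1) that B(1) by (force simp: relation_of_def)
      then show "\<exists>m\<in>B. \<forall>x\<in>B. m \<le> x" using z(1) by blast
    qed
  next
    assume R: ?R
    show ?L
    proof (rule wfI_min)
      fix x :: 'a and Q assume x: "x \<in> Q"
      show "\<exists>z\<in>Q. \<forall>y. (y, z) \<in> relation_of (\<le>) A - Id \<longrightarrow> y \<notin> Q"
      proof (cases "Q \<inter> A = {}")
        case True
        then show ?thesis using x by (auto simp: relation_of_def)
      next
        case False
        then obtain m where "m \<in> Q \<inter> A" "\<forall>x\<in>Q \<inter> A. m \<le> x"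
          using R by (metis inf_le2)
        then show ?thesis by (intro bexI[of _ m]) (auto simp: relation_of_def dest: order.antisym)
      qed
    qed
  qed
  then show ?thesis using lin by (simp add: well_ordered_def well_order_on_def)
qed

lemma well_ordered_subset: "well_ordered A \<Longrightarrow> B \<subseteq> A \<Longrightarrow> well_ordered B"
  by (simp add: well_ordered_iff)

lemma well_ordered_Un:
  assumes A: "well_ordered A" and B: "well_ordered B"
  shows "well_ordered (A \<union> B)"
  unfolding well_ordered_iff
proof (intro allI impI)
  fix C assume C: "C \<subseteq> A \<union> B" "C \<noteq> {}"
  show "\<exists>m\<in>C. \<forall>x\<in>C. m \<le> x"
  proof (cases "C \<inter> A = {} \<or> C \<inter> B = {}")
    case True
    then have "C \<subseteq> A \<or> C \<subseteq> B" using C by blast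
    then show ?thesis using A B C(2) by (auto simp: well_ordered_iff)
  next
    case False
    then obtain a b where a: "a \<in> C \<inter> A" "\<forall>x\<in>C \<inter> A. a \<le> x" and b: "b \<in> C \<inter> B" "\<forall>x\<in>C \<inter> B. b \<le> x"
      using A B by (metis well_ordered_iff inf_le2)
    have "min a b \<in> C" using a b by (auto simp: min_def)
    moreover have "\<forall>x\<in>C. min a b \<le> x" using a b C(1) by (auto simp: min_le_iff_disj)
    ultimately show ?thesis by blast
  qed
qed

text \<open>The type \<open>('t, 'g) Gam\<close> is the group of functions \<open>'t \<Rightarrow> 'g\<close> with well ordered support,
  \<open>coeff\<close> being its inclusion into the group of all functions; the operations are componentwise
  and the order is lexicographic.\<close>

typedef (overloaded) ('t::linorder, 'g::linordered_ab_group_add) Gam =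
  "{f :: 't \<Rightarrow> 'g. well_ordered (supp f)}"
  morphisms coeff Abs_Gam
  by (rule exI[of _ "\<lambda>_. 0"]) (simp add: supp_def well_ordered_iff)

setup_lifting type_definition_Gam

lemma well_ordered_supp_coeff: "well_ordered (supp (coeff f))"
  using coeff[of f] by simp

instantiation Gam :: (linorder, linordered_ab_group_add) ab_group_add
begin

lift_definition zero_Gam :: "('a, 'b) Gam" is "\<lambda>_. 0"
  by (simp add: supp_def well_ordered_iff)

lift_definition plus_Gam :: "('a, 'b) Gam \<Rightarrow> ('a, 'b) Gam \<Rightarrow> ('a, 'b) Gam" is "\<lambda>f g t. f t + g t"
  by (rule well_ordered_subset[OF well_ordered_Un], assumption, assumption) (auto simp: supp_def)

lift_definition uminus_Gam :: "('a, 'b) Gam \<Rightarrow> ('a, 'b) Gam" is "\<lambda>f t. - f t"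
  by (simp add: supp_def)

lift_definition minus_Gam :: "('a, 'b) Gam \<Rightarrow> ('a, 'b) Gam \<Rightarrow> ('a, 'b) Gam" is "\<lambda>f g t. f t - g t"
  by (rule well_ordered_subset[OF well_ordered_Un], assumption, assumption) (auto simp: supp_def)

instance
  by standard (transfer; simp add: fun_eq_iff algebra_simps)+

end

text \<open>\<open>lex_less f g\<close>: at the smallest \<open>t\<close> in the union of the supports where \<open>f\<close> and \<open>g\<close>
  differ, \<open>f t < g t\<close>.\<close>

definition lex_less :: "('t::linorder \<Rightarrow> 'g::{zero,linorder}) \<Rightarrow> ('t \<Rightarrow> 'g) \<Rightarrow> bool" where
  "lex_less f g \<longleftrightarrow>
     (\<exists>t \<in> supp f \<union> supp g. f t \<noteq> g t \<and>
        (\<forall>s \<in> supp f \<union> supp g. f s \<noteq> g s \<longrightarrow> t \<le> s) \<and> f t < g t)"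

lemma lex_less_iff: "lex_less f g \<longleftrightarrow> (\<exists>t. f t < g t \<and> (\<forall>s<t. f s = g s))"
  unfolding lex_less_def supp_def by (force simp: not_le)

lemma lex_less_asym: "lex_less f g \<Longrightarrow> \<not> lex_less g f"
  unfolding lex_less_iff by (metis less_asym less_irrefl linorder_cases)

lemma lex_less_trans: "lex_less f g \<Longrightarrow> lex_less g h \<Longrightarrow> lex_less f h"
proof -
  assume "lex_less f g" "lex_less g h"
  then obtain s t where s: "f s < g s" "\<forall>r<s. f r = g r" and t: "g t < h t" "\<forall>r<t. g r = h r"
    unfolding lex_less_iff by blast
  have "f (min s t) < h (min s t)" 
    using s t by (cases s t rule: linorder_cases) (auto simp: min_def)
  then show ?thesis using s t unfolding lex_less_iff by (metis min_less_iff_conj)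
qed

lemma lex_less_linear:
  assumes "well_ordered (supp f)" "well_ordered (supp g)" "f \<noteq> g"
  shows "lex_less f g \<or> lex_less g f"
proof -
  let ?D = "{t. f t \<noteq> g t}"
  have "?D \<subseteq> supp f \<union> supp g" by (auto simp: supp_def)
  moreover have "?D \<noteq> {}" using assms(3) by auto
  ultimately obtain m where "m \<in> ?D" "\<forall>x\<in>?D. m \<le> x"
    using well_ordered_Un[OF assms(1,2)] unfolding well_ordered_iff by meson
  then show ?thesis unfolding lex_less_iff
    by (smt (verit) mem_Collect_eq linorder_neqE linorder_not_le)
qed

instantiation Gam :: (linorder, linordered_ab_group_add) linordered_ab_group_add
begin

definition less_Gam :: "('a, 'b) Gam \<Rightarrow> ('a, 'b) Gam \<Rightarrow> bool" where
  "f < g \<longleftrightarrow> lex_less (coeff f) (coeff g)"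

definition less_eq_Gam :: "('a, 'b) Gam \<Rightarrow> ('a, 'b) Gam \<Rightarrow> bool" where
  "f \<le> g \<longleftrightarrow> f = g \<or> lex_less (coeff f) (coeff g)"

instance
proof
  fix f g h :: "('a, 'b) Gam"
  show "f < g \<longleftrightarrow> f \<le> g \<and> \<not> g \<le> f"
    unfolding less_Gam_def less_eq_Gam_def using lex_less_asym by blast
  show "f \<le> f" by (simp add: less_eq_Gam_def)
  show "f \<le> g \<Longrightarrow> g \<le> h \<Longrightarrow> f \<le> h"
    unfolding less_eq_Gam_def using lex_less_trans by blast
  show "f \<le> g \<Longrightarrow> g \<le> f \<Longrightarrow> f = g"
    unfolding less_eq_Gam_def using lex_less_asym by blast
  show "f \<le> g \<or> g \<le> f"
    unfolding less_eq_Gam_def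
    using lex_less_linear[OF well_ordered_supp_coeff well_ordered_supp_coeff] coeff_inject by blast
  show "f \<le> g \<Longrightarrow> h + f \<le> h + g"
    unfolding less_eq_Gam_def lex_less_iff by (auto simp: plus_Gam.rep_eq)
qed

end

definition T_isolated :: "'t::linorder \<Rightarrow> ('t, 'g::linordered_ab_group_add) Gam set" where
  "T_isolated t = {f. \<forall>s<t. coeff f s = 0}"

end

theory Submission
  imports Defs
begin

text \<open>A nonzero member \<open>h\<close> of an isolated subgroup \<open>H\<close> with least support element \<open>t\<close> forces
  \<open>H\<^sub>t \<subseteq> H\<close>: the \<open>t\<close>-coefficients of the members of \<open>H \<inter> H\<^sub>t\<close> form a nonzero isolated
  subgroup of \<open>G\<close>, hence all of \<open>G\<close>, so every member of \<open>H\<^sub>t\<close> is bounded in absolute value by a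
  member of \<open>H\<close>. Consequently \<open>{f. \<forall>s\<le>t. f s = 0}\<close> is an immediate predecessor of \<open>H\<^sub>t\<close>; and if
  \<open>K\<close> is an immediate predecessor of \<open>H\<close>, then \<open>K \<subset> H\<^sub>t \<subseteq> H\<close> for \<open>t\<close> the least support element
  of any member of \<open>H - K\<close>.\<close>

lemma less_Gam_iff: "f < g \<longleftrightarrow> (\<exists>t. coeff f t < coeff g t \<and> (\<forall>s<t. coeff f s = coeff g s))"
  by (simp add: less_Gam_def lex_less_iff)

lemma Gam_nonzero_leading:
  assumes "f \<noteq> 0"
  obtains t where "coeff f t \<noteq> 0" "\<forall>s<t. coeff f s = 0"
proof -
  have "\<exists>t. coeff f t \<noteq> 0 \<and> (\<forall>s<t. coeff f s = 0)"
    \<comment> \<open>The order is total, so \<open>f < 0\<close> or \<open>0 < f\<close>. The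
      position deciding either comparison is the least support element.\<close>
    using assms neq_iff[of f 0] unfolding less_Gam_iff by (force simp: zero_Gam.rep_eq)
  then show thesis using that by blast
qed

lift_definition single :: "'t::linorder \<Rightarrow> 'g::linordered_ab_group_add \<Rightarrow> ('t, 'g) Gam" is
  "\<lambda>t a s. if s = t then a else 0"
proof -
  fix t :: 't and a :: 'g
  have "supp (\<lambda>s. if s = t then a else 0) \<subseteq> {t}" by (auto simp: supp_def)
  moreover have "well_ordered {t}" unfolding well_ordered_iff by (auto simp: subset_singleton_iff)
  ultimately show "well_ordered (supp (\<lambda>s. if s = t then a else 0))"
    by (rule well_ordered_subset[rotated])
qed

lemma isolated_subgroup_between:
  assumes "isolated_subgroup H" "k \<in> H" "- k \<le> f" "f \<le> k"
  shows "f \<in> H"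
proof (cases "0 \<le> f")
  case True
  then show ?thesis using assms unfolding isolated_subgroup_def by (meson order.trans)
next
  case False
  then have "0 \<le> - f" "- f \<le> k" using assms(3) by (auto simp: minus_le_iff)
  then have "- f \<in> H" using assms unfolding isolated_subgroup_def by (meson order.trans)
  then show ?thesis using assms(1) unfolding isolated_subgroup_def add_subgroup_def
    by (metis minus_minus)
qed

text \<open>This yields both \<open>T_isolated t\<close> (with \<open>{..<t}\<close>) and its
  predecessor (with \<open>{..t}\<close>). If \<open>0 \<le> g \<le> h\<close> and \<open>g\<close>
  is nonzero somewhere on \<open>L\<close>, the leading position of \<open>g\<close> lies in
  \<open>L\<close>, where \<open>h\<close> vanishes at and below it, so \<open>g\<close> would
  exceed \<open>h\<close>.\<close>

lemma isolated_vanishing_on_down_set: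
  assumes down: "\<And>s t. t \<in> L \<Longrightarrow> s < t \<Longrightarrow> s \<in> L"
  shows "{f. \<forall>s\<in>L. coeff f s = 0} \<in> isolated"
proof -
  have "coeff g s = 0" if "\<forall>s\<in>L. coeff h s = 0" "0 \<le> g" "g \<le> h" "s \<in> L" for g h s
  proof (rule ccontr)
    assume nz: "coeff g s \<noteq> 0"
    then have "0 < g" "g < h" using that(1,4) \<open>0 \<le> g\<close> \<open>g \<le> h\<close>
      by (auto simp: less_le zero_Gam.rep_eq)
    obtain u where u: "0 < coeff g u" "\<forall>s<u. coeff g s = 0"
      using \<open>0 < g\<close> unfolding less_Gam_iff by (auto simp: zero_Gam.rep_eq)
    obtain v where v: "coeff g v < coeff h v" "\<forall>s<v. coeff g s = coeff h s"
      using \<open>g < h\<close> unfolding less_Gam_iff by blast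
    have "\<not> s < u" using u(2) nz by blast
    then have "u \<in> L" using down[OF \<open>s \<in> L\<close>] \<open>s \<in> L\<close> by (cases "u = s") auto
    then have hu: "coeff h u = 0" using that(1) by blast
    \<comment> \<open>Here \<open>u\<close> is the leading position of \<open>g\<close> and
      \<open>v\<close> the first difference from \<open>h\<close>. Up to \<open>u\<close> the only
      difference is \<open>0 < coeff g u\<close> against \<open>coeff h u = 0\<close>, which has the
      wrong sign.\<close>
    show False
    proof (cases u v rule: linorder_cases)
      case less
      then show False using u(1) v(2) hu by auto
    next
      case equal
      then show False using u(1) v(1) hu by auto
    next
      case greater
      then have "coeff h v = 0" using that(1) down[OF \<open>u \<in> L\<close>] by blast
      then show False using u(2) v(1) greater by auto
    qed
  qed
  then show ?thesis
    unfolding isolated_def isolated_subgroup_def add_subgroup_def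
    by (auto simp: zero_Gam.rep_eq plus_Gam.rep_eq uminus_Gam.rep_eq)
qed

lemma T_isolated_isolated: "T_isolated t \<in> isolated"
proof -
  have "T_isolated t = {f. \<forall>s\<in>{..<t}. coeff f s = 0}" by (auto simp: T_isolated_def)
  also have "\<dots> \<in> isolated" by (rule isolated_vanishing_on_down_set) auto
  finally show ?thesis .
qed

lemma isolated_leading_coeffs:
  assumes H: "isolated_subgroup H"
  shows "(\<lambda>f. coeff f t) ` (H \<inter> T_isolated t) \<in> isolated"
    (is "?A \<in> isolated")
proof -
  have sub: "add_subgroup H" using H by (simp add: isolated_subgroup_def)
  have A: "a \<in> ?A \<longleftrightarrow> (\<exists>f\<in>H. (\<forall>s<t. coeff f s = 0) \<and> coeff f t = a)" for a
    by (auto simp: T_isolated_def)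
  have "0 \<in> ?A" 
    unfolding A by (rule bexI[of _ 0]) (use sub in \<open>auto simp: add_subgroup_def zero_Gam.rep_eq\<close>)
  moreover have "x + y \<in> ?A" if "x \<in> ?A" "y \<in> ?A" for x y
  proof -
    obtain f g where "f \<in> H" "\<forall>s<t. coeff f s = 0" "coeff f t = x"
      "g \<in> H" "\<forall>s<t. coeff g s = 0" "coeff g t = y"
      using \<open>x \<in> ?A\<close> \<open>y \<in> ?A\<close> unfolding A by blast
    then show ?thesis unfolding A
      by (intro bexI[of _ "f + g"]) (use sub in \<open>auto simp: add_subgroup_def plus_Gam.rep_eq\<close>)
  qed
  moreover have "- x \<in> ?A" if "x \<in> ?A" for x
  proof -
    obtain f where "f \<in> H" "\<forall>s<t. coeff f s = 0" "coeff f t = x"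
      using \<open>x \<in> ?A\<close> unfolding A by blast
    then show ?thesis unfolding A
      by (intro bexI[of _ "- f"]) (use sub in \<open>auto simp: add_subgroup_def uminus_Gam.rep_eq\<close>)
  qed
  moreover have "g \<in> ?A" if "a \<in> ?A" "0 \<le> g" "g \<le> a" for a g
  \<comment> \<open>For \<open>g\<close> strictly between \<open>0\<close> and \<open>a\<close>,
    position \<open>t\<close> alone decides \<open>0 < single t g < f\<close>. With
    \<open>g = a\<close>, later coefficients of \<open>f\<close> could make \<open>f\<close> the
    smaller one.\<close>
  proof (cases "g = a \<or> g = 0")
    case True
    then show ?thesis using \<open>a \<in> ?A\<close> \<open>0 \<in> ?A\<close> by auto
  next
    case False
    obtain f where f: "f \<in> H" "\<forall>s<t. coeff f s = 0" "coeff f t = a"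
      using \<open>a \<in> ?A\<close> unfolding A by blast
    have "0 < single t g"
      unfolding less_Gam_iff using False \<open>0 \<le> g\<close>
      by (intro exI[of _ t]) (auto simp: single.rep_eq zero_Gam.rep_eq)
    moreover have "single t g < f"
      unfolding less_Gam_iff using False \<open>g \<le> a\<close> f
      by (intro exI[of _ t]) (auto simp: single.rep_eq)
    ultimately have "single t g \<in> H"
      using H f(1) unfolding isolated_subgroup_def by (meson less_imp_le order.trans)
    then show ?thesis
      unfolding A by (intro bexI[of _ "single t g"]) (auto simp: single.rep_eq)
  qed
  ultimately show ?thesis
    unfolding isolated_def isolated_subgroup_def add_subgroup_def by blast
qed

lemma T_isolated_subset:
  fixes H :: "('t::linorder, 'g::linordered_ab_group_add) Gam set"
  assumes G: "rank_one TYPE('g)" and H: "H \<in> isolated"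
    and h: "h \<in> H" "coeff h t \<noteq> 0" "\<forall>s<t. coeff h s = 0"
  shows "T_isolated t \<subseteq> H"
proof
  fix f :: "('t, 'g) Gam" assume f: "f \<in> T_isolated t"
  have H': "isolated_subgroup H" using H by (simp add: isolated_def)
  let ?A = "(\<lambda>f. coeff f t) ` (H \<inter> T_isolated t)"
  have "h \<in> H \<inter> T_isolated t" using h by (simp add: T_isolated_def)
  then have "coeff h t \<in> ?A" by (rule imageI)
  then have "?A \<noteq> {0}" using h(2) by (metis singletonD)
  moreover have "?A \<in> {{0}, UNIV}"
    using isolated_leading_coeffs[OF H', of t] G by (simp only: rank_one_def)
  ultimately have "?A = UNIV" by (simp only: insert_iff empty_iff simp_thms)
  \<comment> \<open>This is |f(t)| + |h(t)|. The second summand is positive, so the bounds on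
    \<open>coeff f t\<close> are strict and \<open>- k < f < k\<close> is decided at
    \<open>t\<close>.\<close>
  define b where "b = max (coeff f t) (- coeff f t) + max (coeff h t) (- coeff h t)"
  have "b \<in> ?A" unfolding \<open>?A = UNIV\<close> by (rule UNIV_I)
  then obtain k where k: "k \<in> H" "k \<in> T_isolated t" "coeff k t = b" by (elim imageE IntE) simp
  have "0 < max (coeff h t) (- coeff h t)" using h(2) by (auto simp: less_max_iff_disj)
  then have "max (coeff f t) (- coeff f t) < b" by (simp add: b_def)
  then have "coeff f t < b" "- coeff f t < b" by simp_all
  then have b: "coeff f t < b" "- b < coeff f t" by (simp_all only: minus_less_iff[of b "coeff f t"])
  have "f < k" "- k < f"
    unfolding less_Gam_iff using k f b
    by (intro exI[of _ t]; simp add: T_isolated_def uminus_Gam.rep_eq)+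
  then show "f \<in> H" using isolated_subgroup_between[OF H' k(1)] by auto
qed

theorem lemma3p4:
  assumes "rank_one TYPE('g::linordered_ab_group_add)"
  shows "IS (isolated :: ('t::linorder, 'g) Gam set set) = {T_isolated t | t. True}"
proof (intro equalityI subsetI)
  fix H :: "('t, 'g) Gam set" assume "H \<in> IS isolated"
  then obtain K where H: "H \<in> isolated" and K: "K \<in> isolated" "K \<subset> H"
    and imm: "\<not> (\<exists>C\<in>isolated. K \<subset> C \<and> C \<subset> H)"
    unfolding IS_def immediate_predecessor_def by blast
  obtain h where h: "h \<in> H" "h \<notin> K" using K by blast
  have "0 \<in> K" using K(1) by (simp add: isolated_def isolated_subgroup_def add_subgroup_def)
  then have "h \<noteq> 0" using h by blast
  then obtain t where t: "coeff h t \<noteq> 0" "\<forall>s<t. coeff h s = 0"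
    by (rule Gam_nonzero_leading)
  then have "h \<in> T_isolated t" by (simp add: T_isolated_def)
  have "K \<subseteq> T_isolated t"
  proof
    fix k assume "k \<in> K"
    show "k \<in> T_isolated t"
    proof (rule ccontr)
      \<comment> \<open>The leading position \<open>u\<close> of \<open>k\<close> would precede
        \<open>t\<close>, so \<open>T_isolated u\<close> would be contained in \<open>K\<close> and
        contain \<open>h\<close>.\<close>
      assume nk: "k \<notin> T_isolated t"
      then have "k \<noteq> 0" by (auto simp: T_isolated_def zero_Gam.rep_eq)
      then obtain u where u: "coeff k u \<noteq> 0" "\<forall>s<u. coeff k s = 0"
        by (rule Gam_nonzero_leading)
      obtain s where "s < t" "coeff k s \<noteq> 0" using nk by (auto simp: T_isolated_def)
      then have "u < t" using u(2) by (meson not_less order.strict_trans1)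
      then have "h \<in> T_isolated u" using t by (auto simp: T_isolated_def)
      then show False
        using T_isolated_subset[OF assms K(1) \<open>k \<in> K\<close> u] h(2) by blast
    qed
  qed
  then have "K \<subset> T_isolated t" using \<open>h \<in> T_isolated t\<close> h(2) by blast
  moreover have "T_isolated t \<subseteq> H" by (rule T_isolated_subset[OF assms H h(1) t])
  ultimately have "H = T_isolated t" using imm T_isolated_isolated by blast
  then show "H \<in> {T_isolated t | t. True}" by blast
next
  fix H :: "('t, 'g) Gam set" assume "H \<in> {T_isolated t | t. True}"
  then obtain t where H: "H = T_isolated t" by blast
  define K :: "('t, 'g) Gam set" where "K = {f. \<forall>s\<in>{..t}. coeff f s = 0}"
  have "K \<in> isolated" unfolding K_def by (rule isolated_vanishing_on_down_set) auto
  moreover have "K \<subset> H"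
  proof -
    obtain a :: 'g where "a \<noteq> 0" using assms unfolding rank_one_def by blast
    then have "single t a \<in> H - K" by (auto simp: H K_def T_isolated_def single.rep_eq)
    then show ?thesis by (auto simp: H K_def T_isolated_def)
  qed
  moreover have "\<not> C \<subset> H" if C: "C \<in> isolated" "K \<subset> C" for C
  proof
    assume "C \<subset> H"
    \<comment> \<open>Membership in \<open>H\<close> but not in \<open>K\<close> puts the leading
      position of \<open>c\<close> exactly at \<open>t\<close>, so \<open>C\<close> already contains
      all of \<open>H\<close>.\<close>
    obtain c where c: "c \<in> C" "c \<notin> K" using C(2) by blast
    have vanish: "\<forall>s<t. coeff c s = 0" using c(1) \<open>C \<subset> H\<close> by (auto simp: H T_isolated_def)
    then have "coeff c t \<noteq> 0" using c(2) by (auto simp: K_def le_less)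
    then show False
      using T_isolated_subset[OF assms C(1) c(1) _ vanish] \<open>C \<subset> H\<close> H by blast
  qed
  ultimately show "H \<in> IS isolated"
    using T_isolated_isolated[of t] unfolding IS_def immediate_predecessor_def H by blast
qed

end
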